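(* Let $f$ be a holomorphic function on $\Delta^+$ with $\mathcal{C}^\infty$-smooth extension up to $(-1,1)$ such that $f$ maps $(-1,1)$ into $\Gamma_C$ for some positive number $C$. Suppose also that the set of zeros of $f|_{(-1,1)}$ is discrete and its limit point is $0$. If $f$ vanishes to infinite order at $0$, then $f$ vanishes identically.
   Context: $\Delta^+:=\{z\in \mathbb C : |z|<1,\ \mathrm{Im}(z)>0\}$ is the upper half disc; $(-1,1)\subset\partial\Delta^+$ is its diameter. For $C>0$, $\Gamma_C:=\{z\in \mathbb C : |\mathrm{Im}(z)|\le C|\mathrm{Re}(z)|\}$. A function $f$ on $\Delta^+$, extended continuously up to $(-1,1)$, vanishes to infinite order at $0$ if for every $N\in\mathbb N$ one has $\lim_{\Delta^+\ni z\to 0} f(z)/|z|^N=0$. "The set of zeros of $f|_{(-1,1)}$ is discrete and its limit point is $0$" means that every zero of $f|_{(-1,1)}$ in $(-1,1)\setminus\{0\}$ is isolated in the set of zeros and that the zero set has no limit point in $(-1,1)$ other than possibly $0$ (the origin may or may not be an isolated zero). *)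

theory Defs
  imports "HOL-Complex_Analysis.Complex_Analysis"
begin

definition upper_half_disc :: "complex set"
  where "upper_half_disc = {z. norm z < 1 \<and> Im z > 0}"

definition diameter_segment :: "complex set"
  where "diameter_segment = complex_of_real ` {-1<..<1}"

definition double_cone :: "real \<Rightarrow> complex set"
  where "double_cone C = {z. \<bar>Im z\<bar> \<le> C * \<bar>Re z\<bar>}"

text \<open>Iterated real directional derivatives; the head of the list is the direction
  in which one differentiates last.\<close>

primrec iter_deriv ::
  "'a::real_normed_vector list \<Rightarrow> ('a \<Rightarrow> 'b::real_normed_vector) \<Rightarrow> 'a \<Rightarrow> 'b" where
  "iter_deriv [] f = f"
| "iter_deriv (v # vs) f = (\<lambda>x. frechet_derivative (iter_deriv vs f) (at x) v)"

text \<open>Real \<open>C\<^sup>\<infinity>\<close> smoothness on an open set \<open>S\<close> and up to the part \<open>B\<close> of its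
  boundary: \<open>f\<close> is infinitely differentiable on \<open>S\<close>, and \<open>f\<close> and all its partial derivatives
  of every order extend continuously to \<open>S \<union> B\<close>. The values of \<open>f\<close> on \<open>B\<close> are
  those of its continuous extension. The derivatives need separate extensions \<open>g\<close>, since
  \<^const>\<open>frechet_derivative\<close> at a point of \<open>B\<close> would involve values of \<open>f\<close> outside
  \<open>S \<union> B\<close>.\<close>

definition smooth_up_to ::
  "('a::real_normed_vector \<Rightarrow> 'b::real_normed_vector) \<Rightarrow> 'a set \<Rightarrow> 'a set \<Rightarrow> bool" where
  "smooth_up_to f S B \<longleftrightarrow>
     continuous_on (S \<union> B) f \<and>
     (\<forall>vs. \<forall>x\<in>S. iter_deriv vs f differentiable (at x)) \<and>
     (\<forall>vs. \<exists>g. continuous_on (S \<union> B) g \<and> (\<forall>x\<in>S. g x = iter_deriv vs f x))"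

definition vanishes_to_infinite_order_at_0 :: "(complex \<Rightarrow> complex) \<Rightarrow> complex set \<Rightarrow> bool" where
  "vanishes_to_infinite_order_at_0 f S \<longleftrightarrow>
     (\<forall>N::nat. ((\<lambda>z. f z / of_real (norm z ^ N)) \<longlongrightarrow> 0) (at 0 within S))"

end

theory Submission
  imports Defs
begin

text \<open>
  The zero function does not have a discrete zero set, so the hypotheses are in fact contradictory,
  and the proof derives a contradiction from them.

  Suppose first that \<open>Re f \<ge> 0\<close> on the diameter. Since \<open>f\<close> is flat at \<open>0\<close>, the function
  \<open>f z / z ^ k\<close> is continuous on the closed half disc of radius \<open>r < 1\<close> for every \<open>k\<close>, and Cauchy's
  theorem bounds \<open>\<integral> f x / x ^ k dx\<close> over \<open>[-r, r]\<close> by the integral over the half circle, which is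
  \<open>O(r powr -k)\<close>. For even \<open>k\<close> the real part of the first integrand is nonnegative, so a set of
  positive measure inside \<open>[-r\<^sub>2, r\<^sub>2]\<close> with \<open>r\<^sub>2 < r\<close>, on which \<open>Re f\<close> is bounded below by a positive
  constant, contributes at least a constant times \<open>r\<^sub>2 powr -k\<close>. This is impossible as \<open>k\<close> grows.

  In general \<open>Re f\<close> changes sign at zeros of \<open>f\<close> that may accumulate at \<open>0\<close>. The cone condition
  guarantees that zeros of \<open>Re f\<close> on the diameter are zeros of \<open>f\<close>. Choose \<open>\<rho> < r\<close> such that \<open>f\<close> has
  no zeros for \<open>\<rho> \<le> \<bar>x\<bar> \<le> r\<close>; multiplying \<open>f\<close> by \<open>\<plusminus>1\<close> or \<open>\<plusminus>z\<close> makes \<open>Re f\<close> positive there. For each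
  \<open>\<epsilon> > 0\<close> the signs on \<open>\<epsilon> \<le> \<bar>x\<bar> \<le> \<rho>\<close> are corrected by a finite real product
  \<open>B z = \<Prod>(z - b a) / (z - a)\<close>, one factor for each interval between consecutive zeros on which
  \<open>Re f < 0\<close>, cut off at \<open>\<plusminus>\<epsilon>\<close> where necessary; here \<open>a\<close> is the end point of the interval that is farther from \<open>0\<close>
  (\<open>sign_correction\<close>). Three properties of \<open>B\<close> make the argument above work for \<open>f * B\<close>:
  its poles \<open>a\<close> are simple and lie at zeros of \<open>f\<close>, where \<open>f z / (z - a)\<close> extends continuously
  because \<open>f\<close> is \<open>C\<^sup>1\<close> up to the diameter (\<open>has_field_derivative_boundary\<close>, \<open>half_disc_moment\<close>);
  \<open>\<bar>B x\<bar> \<le> 1\<close> for \<open>\<bar>x\<bar> \<le> \<epsilon>\<close>, so that the uncorrected part of the integral is small; and, since the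
  intervals do not overlap, \<open>\<bar>B\<bar>\<close> is bounded on the half circle, and bounded below on
  \<open>[r\<^sub>1, r\<^sub>2]\<close> with \<open>\<rho> < r\<^sub>1\<close>, independently of \<open>\<epsilon>\<close>. So \<open>\<epsilon>\<close> may be chosen depending on \<open>k\<close>
  (\<open>flat_contradiction\<close>).
\<close>

section \<open>Correcting the signs of a real function by a rational function\<close>

text \<open>The intervals \<open>[b a, a]\<close> do not overlap, so their total length is at most that of an interval
  containing them.\<close>

lemma sum_gaps_le:
  fixes b :: "real \<Rightarrow> real"
  assumes "finite A" and "\<epsilon> \<le> \<rho>"
    and "\<And>a. a \<in> A \<Longrightarrow> \<epsilon> \<le> b a \<and> a \<le> \<rho>"
    and "\<And>a a'. a \<in> A \<Longrightarrow> a' \<in> A \<Longrightarrow> a' < a \<Longrightarrow> a' \<le> b a"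
  shows "(\<Sum>a\<in>A. a - b a) \<le> \<rho> - \<epsilon>"
  using assms
proof (induction A arbitrary: \<rho> rule: finite_linorder_max_induct)
  case empty
  then show ?case by simp
next
  case (insert m A)
  have "(\<Sum>a\<in>A. a - b a) \<le> b m - \<epsilon>"
    using insert.hyps insert.prems by (intro insert.IH) auto
  moreover have "m \<le> \<rho>" using insert.prems by auto
  moreover have "m \<notin> A" using insert.hyps by auto
  ultimately show ?case using insert.hyps by simp
qed

lemma same_sign_if_no_zero:
  fixes \<phi> :: "real \<Rightarrow> real"
  assumes "continuous_on {x..y} \<phi>" "x \<le> y" "\<And>t. t \<in> {x..y} \<Longrightarrow> \<phi> t \<noteq> 0"
  shows "\<phi> x < 0 \<longleftrightarrow> \<phi> y < 0"
proof (rule ccontr)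
  assume n: "(\<phi> x < 0) \<noteq> (\<phi> y < 0)"
  have "\<exists>t. x \<le> t \<and> t \<le> y \<and> \<phi> t = 0"
  proof (cases "\<phi> x < 0")
    case True
    then show ?thesis using n assms by (intro IVT') auto
  next
    case False
    then show ?thesis using n assms by (intro IVT2') auto
  qed
  then show False using assms(3) by auto
qed

text \<open>A factor \<open>(x - b a) / (x - a)\<close> is negative exactly on \<open>(b a, a)\<close>. Since \<open>\<phi> \<rho> > 0\<close>, every interval
  between consecutive zeros on which \<open>\<phi>\<close> is negative ends, on the right, at a zero of \<open>\<phi>\<close>; the left
  end is a zero or \<open>\<epsilon>\<close>. At \<open>x = a\<close> the product is \<open>0\<close>, as division by \<open>0\<close> yields \<open>0\<close>.\<close>

lemma sign_correction_right:
  fixes \<phi> :: "real \<Rightarrow> real"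
  assumes "\<epsilon> < \<rho>" and cont: "continuous_on {\<epsilon>..\<rho>} \<phi>"
    and fin: "finite {x\<in>{\<epsilon>..\<rho>}. \<phi> x = 0}" and pos: "\<phi> \<rho> > 0"
  obtains P b where "finite P"
    and "\<And>a. a \<in> P \<Longrightarrow> \<phi> a = 0 \<and> \<epsilon> \<le> b a \<and> b a < a \<and> a < \<rho>"
    and "(\<Sum>a\<in>P. a - b a) \<le> \<rho> - \<epsilon>"
    and "\<And>x. x \<in> {\<epsilon>..\<rho>} \<Longrightarrow> 0 \<le> \<phi> x * (\<Prod>a\<in>P. (x - b a) / (x - a))"
proof -
  define N where "N = {x\<in>{\<epsilon><..\<rho>}. \<phi> x = 0}"
  \<comment> \<open>The largest zero below \<open>a\<close>, or \<open>\<epsilon>\<close> if there is none.\<close>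
  define b where "b a = Max (insert \<epsilon> {y\<in>N. y < a})" for a
  \<comment> \<open>The point \<open>b a\<close> itself is admitted for \<open>y\<close> to cover \<open>b a = \<epsilon>\<close> with \<open>\<phi> \<epsilon> < 0\<close>.\<close>
  define P where "P = {a\<in>N. \<exists>y. b a \<le> y \<and> y < a \<and> \<phi> y < 0}"
  have finN: "finite N" unfolding N_def by (rule finite_subset[OF _ fin]) auto
  have finP: "finite P" using finN by (simp add: P_def)
  have ge: "\<epsilon> \<le> b a" for a using finN by (simp add: b_def)
  have lt: "b a < a" if "a \<in> N" for a
    using finN that unfolding b_def by (subst Max_less_iff) (simp_all, simp add: N_def)
  have below: "y \<le> b a" if "y \<in> N" "y < a" for y a
    using finN that by (auto simp: b_def)
  have N_lt: "a < \<rho>" if "a \<in> N" for a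
    using that pos by (cases "a = \<rho>") (auto simp: N_def)
  have same: "\<phi> x < 0 \<longleftrightarrow> \<phi> y < 0"
    if "a \<in> N" "x \<in> {b a..<a}" "y \<in> {b a..<a}" "x \<le> y" "\<phi> x \<noteq> 0" for a x y
  proof (rule same_sign_if_no_zero[of x y \<phi>])
    show "continuous_on {x..y} \<phi>"
      using that ge[of a] N_lt[of a] by (intro continuous_on_subset[OF cont]) auto
    fix t assume t: "t \<in> {x..y}"
    show "\<phi> t \<noteq> 0"
    proof
      assume t0: "\<phi> t = 0"
      with \<open>\<phi> x \<noteq> 0\<close> t have "x < t" by (cases "t = x") auto
      then have "t \<in> N" using t t0 that ge[of a] N_lt[of a] by (auto simp: N_def)
      then show False using below[of t a] t that \<open>x < t\<close> by auto
    qed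
  qed fact
  have neg: "\<phi> x < 0" if a: "a \<in> P" "x \<in> {b a<..<a}" for a x
  proof -
    obtain y where y: "b a \<le> y" "y < a" "\<phi> y < 0" using a by (auto simp: P_def)
    have "a \<in> N" using a by (simp add: P_def)
    have "\<phi> x \<noteq> 0"
    proof
      assume "\<phi> x = 0"
      then have "x \<in> N" using a ge[of a] N_lt[of a] \<open>a \<in> N\<close> by (auto simp: N_def)
      then show False using below[of x a] a by auto
    qed
    then show ?thesis using same[of a x y] same[of a y x] a y \<open>a \<in> N\<close> by (cases "x \<le> y") auto
  qed
  have sgn: "0 \<le> \<phi> x * (\<Prod>a\<in>P. (x - b a) / (x - a))" if x: "x \<in> {\<epsilon>..\<rho>}" for x
  proof (cases "\<phi> x \<ge> 0")
    case True
    have "0 \<le> (x - b a) / (x - a)" if "a \<in> P" for a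
    proof -
      have "x \<notin> {b a<..<a}" using neg[OF that, of x] True by auto
      moreover have "b a < a" using lt that by (simp add: P_def)
      ultimately show ?thesis by (auto simp: zero_le_divide_iff)
    qed
    then show ?thesis using True by (intro mult_nonneg_nonneg prod_nonneg) auto
  next
    case False
    \<comment> \<open>If \<open>\<phi> x < 0\<close>, the factor of the next zero \<open>c\<close> above \<open>x\<close> is the only negative one.\<close>
    define c where "c = Min {y\<in>N. x < y}"
    have "{y\<in>N. x < y} \<noteq> {}"
    proof
      assume e: "{y\<in>N. x < y} = {}"
      have "\<phi> x < 0 \<longleftrightarrow> \<phi> \<rho> < 0"
      proof (rule same_sign_if_no_zero[of x \<rho> \<phi>])
        show "continuous_on {x..\<rho>} \<phi>" using x by (intro continuous_on_subset[OF cont]) auto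
        show "\<phi> t \<noteq> 0" if "t \<in> {x..\<rho>}" for t
          using that e x False by (cases "t = x") (auto simp: N_def)
      qed (use x in auto)
      then show False using False pos by auto
    qed
    then have c: "c \<in> N" "x < c" using finN Min_in[of "{y\<in>N. x < y}"] by (auto simp: c_def)
    have c_le: "c \<le> y" if "y \<in> N" "x < y" for y
      using finN that by (auto simp: c_def)
    have bcx: "b c \<le> x"
      using finN x c_le unfolding b_def by (subst Max_le_iff) (simp_all, force)
    have cP: "c \<in> P" using c bcx False by (auto simp: P_def intro!: exI[of _ x])
    have "0 \<le> (\<Prod>a\<in>P - {c}. (x - b a) / (x - a))"
    proof (intro prod_nonneg ballI)
      fix a assume a: "a \<in> P - {c}"
      then have aN: "a \<in> N" by (simp add: P_def)
      have "x \<notin> {b a<..<a}"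
      proof
        assume xa: "x \<in> {b a<..<a}"
        then have "c < a" using c_le[of a] a aN by auto
        then have "c \<le> b a" using below c by auto
        then show False using xa c by auto
      qed
      then show "0 \<le> (x - b a) / (x - a)" using lt[OF aN] by (auto simp: zero_le_divide_iff)
    qed
    moreover have "(x - b c) / (x - c) \<le> 0" using c bcx by (simp add: divide_le_0_iff)
    ultimately have "(\<Prod>a\<in>P. (x - b a) / (x - a)) \<le> 0"
      unfolding prod.remove[OF finP cP] by (rule mult_nonpos_nonneg[rotated])
    then show ?thesis using False by (simp add: zero_le_mult_iff)
  qed
  show thesis
  proof (rule that[OF finP])
    show "\<phi> a = 0 \<and> \<epsilon> \<le> b a \<and> b a < a \<and> a < \<rho>" if "a \<in> P" for a
      using that ge[of a] lt[of a] N_lt[of a] by (auto simp: P_def N_def)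
    show "(\<Sum>a\<in>P. a - b a) \<le> \<rho> - \<epsilon>"
      using assms(1) ge below N_lt by (intro sum_gaps_le[OF finP]) (auto simp: P_def less_imp_le)
  qed (rule sgn)
qed

text \<open>The two-sided version, with each pole \<open>a\<close> farther from \<open>0\<close> than the zero \<open>b a\<close>.\<close>

lemma sign_correction:
  fixes \<phi> :: "real \<Rightarrow> real"
  assumes "0 < \<epsilon>" "\<epsilon> < \<rho>"
    and cont: "continuous_on {-\<rho>..\<rho>} \<phi>"
    and fin: "finite {x. \<epsilon> \<le> \<bar>x\<bar> \<and> \<bar>x\<bar> \<le> \<rho> \<and> \<phi> x = 0}"
    and pos: "\<phi> \<rho> > 0" "\<phi> (-\<rho>) > 0"
  obtains P b where "finite P"
    and "\<And>a. a \<in> P \<Longrightarrow> \<phi> a = 0 \<and> \<bar>a\<bar> < \<rho> \<and> (\<epsilon> \<le> b a \<and> b a < a \<or> a < b a \<and> b a \<le> -\<epsilon>)"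
    and "(\<Sum>a\<in>P. \<bar>a - b a\<bar>) \<le> 2 * \<rho>"
    and "\<And>x. \<epsilon> \<le> \<bar>x\<bar> \<Longrightarrow> \<bar>x\<bar> \<le> \<rho> \<Longrightarrow> 0 \<le> \<phi> x * (\<Prod>a\<in>P. (x - b a) / (x - a))"
proof -
  have "finite {x\<in>{\<epsilon>..\<rho>}. \<phi> x = 0}"
    by (rule finite_subset[OF _ fin]) (use assms(1) in auto)
  moreover have "continuous_on {\<epsilon>..\<rho>} \<phi>"
    by (rule continuous_on_subset[OF cont]) (use assms(1,2) in auto)
  ultimately obtain P1 b1 where P1: "finite P1"
    and b1: "\<And>a. a \<in> P1 \<Longrightarrow> \<phi> a = 0 \<and> \<epsilon> \<le> b1 a \<and> b1 a < a \<and> a < \<rho>"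
    and s1: "(\<Sum>a\<in>P1. a - b1 a) \<le> \<rho> - \<epsilon>"
    and n1: "\<And>x. x \<in> {\<epsilon>..\<rho>} \<Longrightarrow> 0 \<le> \<phi> x * (\<Prod>a\<in>P1. (x - b1 a) / (x - a))"
    using sign_correction_right[of \<epsilon> \<rho> \<phi>] assms(2) pos(1) by blast
  have "finite (uminus -` {x. \<epsilon> \<le> \<bar>x\<bar> \<and> \<bar>x\<bar> \<le> \<rho> \<and> \<phi> x = 0})"
    using fin by (intro finite_vimageI) auto
  then have "finite {x\<in>{\<epsilon>..\<rho>}. \<phi> (-x) = 0}"
    by (rule finite_subset[rotated]) (use assms(1) in auto)
  moreover have "continuous_on {\<epsilon>..\<rho>} (\<lambda>x. \<phi> (-x))"
    by (intro continuous_on_compose2[OF cont] continuous_intros) (use assms(1,2) in auto)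
  ultimately obtain P2 b2 where P2: "finite P2"
    and b2: "\<And>a. a \<in> P2 \<Longrightarrow> \<phi> (-a) = 0 \<and> \<epsilon> \<le> b2 a \<and> b2 a < a \<and> a < \<rho>"
    and s2: "(\<Sum>a\<in>P2. a - b2 a) \<le> \<rho> - \<epsilon>"
    and n2: "\<And>x. x \<in> {\<epsilon>..\<rho>} \<Longrightarrow> 0 \<le> \<phi> (-x) * (\<Prod>a\<in>P2. (x - b2 a) / (x - a))"
    using sign_correction_right[of \<epsilon> \<rho> "\<lambda>x. \<phi> (-x)"] assms(2) pos(2) by blast
  define b where "b a = (if a > 0 then b1 a else - b2 (-a))" for a
  define P where "P = P1 \<union> uminus ` P2"
  have b_P1: "b a = b1 a" if "a \<in> P1" for a
    using b1[OF that] assms(1) by (simp add: b_def)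
  have b_P2: "b (-a) = - b2 a" if "a \<in> P2" for a
    using b2[OF that] assms(1) by (simp add: b_def)
  have "P1 \<inter> uminus ` P2 = {}"
    using b1 b2 assms(1) by fastforce
  note dis = P1 finite_imageI[OF P2] this
  show thesis
  proof (rule that)
    show "finite P" using P1 P2 by (simp add: P_def)
    show "\<phi> a = 0 \<and> \<bar>a\<bar> < \<rho> \<and> (\<epsilon> \<le> b a \<and> b a < a \<or> a < b a \<and> b a \<le> -\<epsilon>)" if "a \<in> P" for a
      using that unfolding P_def
    proof
      assume "a \<in> P1"
      then show ?thesis using b1[of a] b_P1[of a] assms(1) by auto
    next
      assume "a \<in> uminus ` P2"
      then obtain c where c: "c \<in> P2" "a = - c" by auto
      then show ?thesis using b2[of c] b_P2[of c] assms(1) by auto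
    qed
    have "(\<Sum>a\<in>P1. \<bar>a - b a\<bar>) = (\<Sum>a\<in>P1. a - b1 a)"
      using b1 b_P1 by (intro sum.cong) force+
    moreover have "(\<Sum>a\<in>P2. \<bar>- a - b (-a)\<bar>) = (\<Sum>a\<in>P2. a - b2 a)"
      using b2 b_P2 by (intro sum.cong) force+
    ultimately show "(\<Sum>a\<in>P. \<bar>a - b a\<bar>) \<le> 2 * \<rho>"
      using s1 s2 assms(1) by (simp add: P_def sum.union_disjoint[OF dis] sum.reindex)
    fix x assume x: "\<epsilon> \<le> \<bar>x\<bar>" "\<bar>x\<bar> \<le> \<rho>"
    have e1: "(\<Prod>a\<in>P1. (x - b a) / (x - a)) = (\<Prod>a\<in>P1. (x - b1 a) / (x - a))"
      using b_P1 by (intro prod.cong) auto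
    have e2: "(\<Prod>a\<in>P2. (x - b (-a)) / (x + a)) = (\<Prod>a\<in>P2. (-x - b2 a) / (-x - a))"
    proof (intro prod.cong refl)
      fix a assume "a \<in> P2"
      have "(x + b2 a) / (x + a) = (-(x + b2 a)) / (-(x + a))" by (simp only: minus_divide_divide)
      then show "(x - b (-a)) / (x + a) = (-x - b2 a) / (-x - a)"
        using b_P2[OF \<open>a \<in> P2\<close>] by simp
    qed
    have split: "(\<Prod>a\<in>P. (x - b a) / (x - a)) =
      (\<Prod>a\<in>P1. (x - b1 a) / (x - a)) * (\<Prod>a\<in>P2. (-x - b2 a) / (-x - a))"
      unfolding P_def prod.union_disjoint[OF dis] by (simp add: prod.reindex e1 e2)
    show "0 \<le> \<phi> x * (\<Prod>a\<in>P. (x - b a) / (x - a))"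
    proof (cases "x > 0")
      case True
      have "0 \<le> (\<Prod>a\<in>P2. (-x - b2 a) / (-x - a))"
        using True b2 assms(1) by (intro prod_nonneg divide_nonpos_nonpos) force+
      moreover have "0 \<le> \<phi> x * (\<Prod>a\<in>P1. (x - b1 a) / (x - a))"
        using n1[of x] True x by auto
      ultimately show ?thesis
        by (simp only: split mult.assoc[symmetric]) (rule mult_nonneg_nonneg)
    next
      case False
      have "0 \<le> (\<Prod>a\<in>P1. (x - b1 a) / (x - a))"
        using False b1 assms(1) by (intro prod_nonneg divide_nonpos_nonpos) force+
      moreover have "0 \<le> \<phi> x * (\<Prod>a\<in>P2. (-x - b2 a) / (-x - a))"
        using n2[of "-x"] False x by auto
      ultimately show ?thesis
        by (simp only: split mult.left_commute[of "\<phi> x"]) (rule mult_nonneg_nonneg)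
    qed
  qed
qed

section \<open>Boundary behaviour of holomorphic functions\<close>

lemma prod_le_exp_sum:
  fixes h :: "'i \<Rightarrow> real"
  assumes "\<And>i. i \<in> P \<Longrightarrow> 0 \<le> h i" "\<And>i. i \<in> P \<Longrightarrow> h i \<le> exp (s i)"
  shows "(\<Prod>i\<in>P. h i) \<le> exp (\<Sum>i\<in>P. s i)"
proof (cases "finite P")
  case True
  then show ?thesis using assms by (simp add: exp_sum prod_mono)
qed simp

lemma approximate_from_dense_subset:
  fixes z :: "'a::metric_space"
  assumes "T \<subseteq> closure S" "open U" "z \<in> T \<inter> U"
  obtains X where "\<And>n. X n \<in> S \<inter> U" "X \<longlonglongrightarrow> z"
proof -
  have "z \<in> closure (S \<inter> U)"
    using assms open_Int_closure_subset[of U S] by (auto simp: Int_commute)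
  then show thesis using that by (auto simp: closure_sequential)
qed

text \<open>A holomorphic function that is \<open>C\<^sup>1\<close> up to part of the boundary of a convex open set has the
  expected one-sided complex derivative there: the mean value inequality for \<open>f z - g a * z\<close> holds in
  the interior near \<open>a\<close> and passes to the boundary by continuity.\<close>

lemma has_field_derivative_boundary:
  fixes f g :: "complex \<Rightarrow> complex"
  assumes S: "open S" "convex S" and TS: "T \<subseteq> closure S" "S \<subseteq> T"
    and f: "continuous_on T f" and g: "continuous_on T g"
    and der: "\<And>z. z \<in> S \<Longrightarrow> (f has_field_derivative g z) (at z)"
    and a: "a \<in> T"
  shows "(f has_field_derivative g a) (at a within T)"
proof -
  define h where "h z = f z - g a * z" for z
  have h: "continuous_on T h" unfolding h_def by (intro continuous_intros f)
  have bnd: "\<exists>d>0. \<forall>z\<in>T. dist z a < d \<longrightarrow> norm (h z - h a) \<le> e * norm (z - a)" if "e > 0" for e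
  proof -
    obtain d where d: "d > 0" "\<And>z. z \<in> T \<Longrightarrow> dist z a < d \<Longrightarrow> dist (g z) (g a) < e"
      using g a \<open>e > 0\<close> unfolding continuous_on_iff by metis
    let ?U = "S \<inter> ball a d"
    have inner: "norm (h z - h w) \<le> e * norm (z - w)" if "z \<in> ?U" "w \<in> ?U" for z w
    proof (rule field_differentiable_bound[where S = ?U and f' = "\<lambda>z. g z - g a"])
      show "convex ?U" using S by (intro convex_Int) auto
      show "(h has_field_derivative g z - g a) (at z within ?U)" if "z \<in> ?U" for z
        unfolding h_def using that
        by (auto intro!: derivative_eq_intros DERIV_subset[OF der])
      show "norm (g z - g a) \<le> e" if "z \<in> ?U" for z
        using d(2)[of z] that TS by (auto simp: dist_norm norm_minus_commute dist_commute less_imp_le)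
    qed fact+
    have "norm (h z - h a) \<le> e * norm (z - a)" if z: "z \<in> T" "dist z a < d" for z
    proof -
      obtain X where X: "\<And>n. X n \<in> ?U" "X \<longlonglongrightarrow> z"
        using approximate_from_dense_subset[OF TS(1) open_ball, of z a d] z by (auto simp: dist_commute)
      obtain Y where Y: "\<And>n. Y n \<in> ?U" "Y \<longlonglongrightarrow> a"
        using approximate_from_dense_subset[OF TS(1) open_ball, of a a d] a d(1) by auto
      have hX: "(\<lambda>n. h (X n)) \<longlonglongrightarrow> h z"
        using h X z TS by (intro continuous_on_tendsto_compose[OF h] always_eventually) auto
      have hY: "(\<lambda>n. h (Y n)) \<longlonglongrightarrow> h a"
        using h Y a TS by (intro continuous_on_tendsto_compose[OF h] always_eventually) auto
      show ?thesis
      proof (rule LIMSEQ_le)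
        show "(\<lambda>n. norm (h (X n) - h (Y n))) \<longlonglongrightarrow> norm (h z - h a)" by (intro tendsto_intros hX hY)
        show "(\<lambda>n. e * norm (X n - Y n)) \<longlonglongrightarrow> e * norm (z - a)" by (intro tendsto_intros X Y)
      qed (use inner X(1) Y(1) in blast)
    qed
    then show ?thesis using d(1) by blast
  qed
  have "((\<lambda>z. g a * z) has_field_derivative g a) (at a within T)"
    by (auto intro!: derivative_eq_intros)
  moreover have "(h has_field_derivative 0) (at a within T)"
    unfolding has_field_derivative_def has_derivative_within_alt
    using bnd by (auto simp: dist_norm bounded_linear_mult_right)
  ultimately have "((\<lambda>z. h z + g a * z) has_field_derivative 0 + g a) (at a within T)"
    by (intro DERIV_add) 
  then show ?thesis by (simp add: h_def)
qed

lemma continuous_on_extend_finite: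
  fixes H :: "'a::t1_space \<Rightarrow> 'b::topological_space"
  assumes Q: "finite Q" and H: "continuous_on (T - Q) H"
    and l: "\<And>a. a \<in> Q \<inter> T \<Longrightarrow> (H \<longlongrightarrow> l a) (at a within T)"
  shows "continuous_on T (\<lambda>z. if z \<in> Q then l z else H z)" (is "continuous_on T ?H")
  unfolding continuous_on_def
proof
  fix x assume x: "x \<in> T"
  have ev: "eventually (\<lambda>z. H z = ?H z) (at x within T)"
  proof -
    have "open (- (Q - {x}))" using Q by (intro open_Compl finite_imp_closed) auto
    then have "eventually (\<lambda>z. z \<in> - (Q - {x})) (at x within T)"
      by (rule topological_tendstoD[OF tendsto_ident_at]) auto
    moreover have "eventually (\<lambda>z. z \<noteq> x) (at x within T)"
      by (simp add: eventually_at_filter)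
    ultimately show ?thesis by eventually_elim auto
  qed
  have "(H \<longlongrightarrow> ?H x) (at x within T)"
  proof (cases "x \<in> Q")
    case True
    then show ?thesis using l x by simp
  next
    case False
    then have "(H \<longlongrightarrow> H x) (at x within (T - Q))" using H x by (auto simp: continuous_on_def)
    moreover have "at x within (T - Q) = at x within T"
    proof (rule at_within_nhd)
      show "open (- Q)" using Q by (intro open_Compl finite_imp_closed)
    qed (use False in auto)
    ultimately show ?thesis using False by simp
  qed
  then show "(?H \<longlongrightarrow> ?H x) (at x within T)"
    using tendsto_cong[OF ev] by simp
qed

section \<open>Moments of a flat function on a half disc\<close>

text \<open>Cauchy's theorem for \<open>H z = g z * \<Prod>(z - b a) / (z - a) / z ^ k\<close> on the closed half disc. The
  singularities of \<open>H\<close> on the diameter are removable: at \<open>0\<close> because \<open>g\<close> is flat, at \<open>a \<in> P\<close> because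
  \<open>g\<close> vanishes and has a one-sided derivative there.\<close>

lemma half_disc_moment:
  fixes g :: "complex \<Rightarrow> complex" and b :: "real \<Rightarrow> real" and P :: "real set"
    and k :: nat and r :: real
  defines "T \<equiv> {z. norm z \<le> r \<and> 0 \<le> Im z}"
  defines "H \<equiv> \<lambda>z. g z * (\<Prod>a\<in>P. (z - of_real (b a)) / (z - of_real a)) / z ^ k"
  assumes "r > 0" and cont: "continuous_on T g"
    and hol: "g holomorphic_on {z. norm z < r \<and> 0 < Im z}"
    and flat: "\<delta> > 0" "\<And>z. z \<in> T \<Longrightarrow> norm z < \<delta> \<Longrightarrow> norm (g z) \<le> norm z ^ Suc k"
    and P: "finite P" "\<And>a. a \<in> P \<Longrightarrow> a \<noteq> 0 \<and> \<bar>a\<bar> < r \<and> g (of_real a) = 0"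
    and der: "\<And>a. a \<in> P \<Longrightarrow> \<exists>D. (g has_field_derivative D) (at (of_real a) within T)"
    and bound: "\<And>z. z \<in> T \<Longrightarrow> norm z = r \<Longrightarrow> norm (H z) \<le> E"
  obtains I where "((\<lambda>x. H (of_real x)) has_integral I) {-r..r}" "norm I \<le> E * r * pi"
proof -
  let ?Q = "insert 0 (of_real ` P) :: complex set"
  have finQ: "finite ?Q" using P by auto
  have H_cont: "continuous_on (T - ?Q) H"
    unfolding H_def using P by (intro continuous_intros continuous_on_subset[OF cont]) auto
  have "\<exists>l. (H \<longlongrightarrow> l) (at q within T)" if "q \<in> ?Q" for q
  proof (cases "q = 0")
    case True
    have "((\<lambda>z. g z / z ^ k) \<longlongrightarrow> 0) (at 0 within T)"
    proof (rule Lim_null_comparison)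
      have "eventually (\<lambda>z. dist z 0 < \<delta> \<and> z \<in> T \<and> z \<noteq> 0) (at 0 within T)"
        using \<open>\<delta> > 0\<close> by (auto simp: eventually_at)
      then show "eventually (\<lambda>z. norm (g z / z ^ k) \<le> norm z) (at 0 within T)"
      proof eventually_elim
        case (elim z)
        then have "norm (g z) \<le> norm z ^ Suc k" using flat(2)[of z] by simp
        then show ?case using elim by (simp add: norm_divide norm_power divide_simps)
      qed
      show "(norm \<longlongrightarrow> 0) (at (0::complex) within T)"
        by (intro tendsto_norm_zero tendsto_ident_at)
    qed
    moreover have "((\<lambda>z. \<Prod>a\<in>P. (z - of_real (b a)) / (z - of_real a)) \<longlongrightarrow>
        (\<Prod>a\<in>P. (0 - of_real (b a)) / (0 - of_real a))) (at (0::complex) within T)"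
      using P by (intro tendsto_intros) auto
    ultimately have "((\<lambda>z. g z / z ^ k * (\<Prod>a\<in>P. (z - of_real (b a)) / (z - of_real a))) \<longlongrightarrow>
        0 * (\<Prod>a\<in>P. (0 - of_real (b a)) / (0 - of_real a))) (at (0::complex) within T)"
      by (rule tendsto_mult)
    then show ?thesis unfolding H_def True by (intro exI) (simp add: field_simps)
  next
    case False
    then obtain a where a: "a \<in> P" "q = of_real a" using \<open>q \<in> ?Q\<close> by auto
    obtain D where D: "(g has_field_derivative D) (at q within T)" using der a by auto
    have "((\<lambda>z. (g z - g q) / (z - q)) \<longlongrightarrow> D) (at q within T)"
      using D by (simp add: has_field_derivative_iff)
    moreover have "g q = 0" using P a by auto
    ultimately have "((\<lambda>z. g z / (z - q)) \<longlongrightarrow> D) (at q within T)" by simp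
    moreover have "((\<lambda>z. \<Prod>c\<in>P-{a}. (z - of_real (b c)) / (z - of_real c)) \<longlongrightarrow>
        (\<Prod>c\<in>P-{a}. (q - of_real (b c)) / (q - of_real c))) (at q within T)"
      using a by (intro tendsto_intros) auto
    ultimately have "((\<lambda>z. g z / (z - q) * ((z - of_real (b a)) *
        (\<Prod>c\<in>P-{a}. (z - of_real (b c)) / (z - of_real c)) / z ^ k)) \<longlongrightarrow>
        D * ((q - of_real (b a)) * (\<Prod>c\<in>P-{a}. (q - of_real (b c)) / (q - of_real c)) / q ^ k))
        (at q within T)"
      using False a(2) by (intro tendsto_intros) auto
    moreover have "H = (\<lambda>z. g z / (z - q) * ((z - of_real (b a)) *
        (\<Prod>c\<in>P-{a}. (z - of_real (b c)) / (z - of_real c)) / z ^ k))"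
      unfolding H_def prod.remove[OF P(1) a(1)] a(2) by (simp add: mult_ac)
    ultimately show ?thesis by auto
  qed
  then obtain l where l: "\<And>q. q \<in> ?Q \<Longrightarrow> (H \<longlongrightarrow> l q) (at q within T)" by metis
  \<comment> \<open>The continuous extension of \<open>H\<close> to \<open>T\<close>.\<close>
  define h where "h z = (if z \<in> ?Q then l z else H z)" for z
  have h_cont: "continuous_on T h"
    unfolding h_def by (rule continuous_on_extend_finite[OF finQ H_cont]) (use l in auto)
  let ?line = "linepath (of_real (-r)) (of_real r) :: real \<Rightarrow> complex"
  let ?arc = "part_circlepath 0 r 0 pi"
  have T_eq: "T = cball 0 r \<inter> {z. 0 \<le> Im z}" by (auto simp: T_def)
  have convex_T: "convex T"
    unfolding T_eq by (intro convex_Int convex_cball convex_halfspace_Im_ge)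
  have int_T: "interior T = {z. norm z < r \<and> 0 < Im z}"
  proof -
    have "interior {z. 0 \<le> Im z} = {z. 0 < Im z}"
      using interior_halfspace_ge[of \<i> 0] by (simp add: inner_complex_def)
    then show ?thesis unfolding T_eq by auto
  qed
  have line_T: "path_image ?line \<subseteq> T"
    using convex_T \<open>r > 0\<close> by (auto simp: T_def closed_segment_subset)
  have arc_T: "path_image ?arc \<subseteq> {z \<in> T. norm z = r}"
    using \<open>r > 0\<close>
    by (auto simp: path_image_part_circlepath' T_def closed_segment_eq_real_ivl cis.ctr
        norm_mult intro!: sin_ge_zero mult_nonneg_nonneg)
  have h_diff: "h field_differentiable at z" if "z \<in> interior T - {}" for z
  proof (rule holomorphic_on_imp_differentiable_at)
    let ?U = "{z. norm z < r \<and> 0 < Im z}"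
    have "H holomorphic_on ?U"
      unfolding H_def by (intro holomorphic_intros hol) auto
    then show "h holomorphic_on ?U"
      by (rule holomorphic_transform) (auto simp: h_def)
    show "open ?U" using open_interior[of T] by (simp add: int_T)
    show "z \<in> ?U" using that by (simp add: int_T)
  qed
  have "(h has_contour_integral 0) (?line +++ ?arc)"
  proof (rule Cauchy_theorem_convex[OF h_cont convex_T _ h_diff])
    show "path_image (?line +++ ?arc) \<subseteq> T"
      using line_T arc_T by (auto simp: path_image_join)
  qed (auto intro!: valid_path_join)
  moreover have line_int: "h contour_integrable_on ?line"
    using h_cont line_T by (intro contour_integrable_continuous_linepath) (auto intro: continuous_on_subset)
  moreover have arc_int: "h contour_integrable_on ?arc"
    using h_cont arc_T by (intro contour_integrable_continuous_part_circlepath) (auto intro: continuous_on_subset)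
  ultimately have sum0: "contour_integral ?line h + contour_integral ?arc h = 0"
    using contour_integral_join[of h ?line ?arc] contour_integral_unique by fastforce
  define I where "I = contour_integral ?line h"
  have "(h has_contour_integral I) ?line"
    using line_int unfolding I_def by (rule has_contour_integral_integral)
  then have "((\<lambda>x. h (of_real x)) has_integral I) {-r..r}"
    using \<open>r > 0\<close> by (subst (asm) has_contour_integral_linepath_Reals_iff) auto
  then have "((\<lambda>x. H (of_real x)) has_integral I) {-r..r}"
  proof (rule has_integral_spike_finite[rotated 2])
    show "finite (insert 0 P)" using P by simp
  qed (auto simp: h_def)
  moreover have "norm I \<le> E * r * pi"
  proof -
    have "norm (contour_integral ?arc h) \<le> E * r * \<bar>pi - 0\<bar>"
    proof (rule contour_integral_bound_part_circlepath[OF arc_int])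
      have "of_real r \<in> T" using \<open>r > 0\<close> by (simp add: T_def)
      from order_trans[OF norm_ge_zero bound[OF this]] show "0 \<le> E" using \<open>r > 0\<close> by simp
      fix z assume "z \<in> path_image ?arc"
      then have z: "z \<in> T" "norm z = r" using arc_T by auto
      then have "z \<notin> ?Q" using P(2) \<open>r > 0\<close> by force
      then show "norm (h z) \<le> E" using bound[OF z] by (simp add: h_def)
    qed (use \<open>r > 0\<close> in auto)
    moreover have "norm I = norm (contour_integral ?arc h)"
      using sum0 by (simp add: I_def add_eq_0_iff)
    ultimately show ?thesis by simp
  qed
  ultimately show thesis by (rule that)
qed

text \<open>The growth argument. The real part of \<open>g\<close> is positive near both ends of the diameter; between
  them it may change sign, but only at zeros of \<open>g\<close>, and only finitely often away from \<open>0\<close>.\<close>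

lemma flat_contradiction:
  fixes g :: "complex \<Rightarrow> complex" and \<rho> r :: real
  defines "T \<equiv> {z. norm z \<le> r \<and> 0 \<le> Im z}"
  assumes r: "0 < \<rho>" "\<rho> < r" "r \<le> 1" and cont: "continuous_on T g"
    and hol: "g holomorphic_on {z. norm z < r \<and> 0 < Im z}"
    and flat: "\<And>k. \<exists>\<delta>>0. \<forall>z\<in>T. norm z < \<delta> \<longrightarrow> norm (g z) \<le> norm z ^ k"
    and der: "\<And>x::real. \<bar>x\<bar> < r \<Longrightarrow> \<exists>D. (g has_field_derivative D) (at (of_real x) within T)"
    and zero: "\<And>x::real. \<bar>x\<bar> < r \<Longrightarrow> Re (g (of_real x)) = 0 \<Longrightarrow> g (of_real x) = 0"
    and pos: "\<And>x::real. \<rho> \<le> \<bar>x\<bar> \<Longrightarrow> \<bar>x\<bar> \<le> r \<Longrightarrow> 0 < Re (g (of_real x))"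
    and fin: "\<And>\<epsilon>. 0 < \<epsilon> \<Longrightarrow> finite {x::real. \<epsilon> \<le> \<bar>x\<bar> \<and> \<bar>x\<bar> \<le> \<rho> \<and> g (of_real x) = 0}"
  shows False
proof -
  have real_T: "of_real x \<in> T" if "\<bar>x\<bar> \<le> r" for x using that by (simp add: T_def)
  have cont_real: "continuous_on {-r..r} (\<lambda>x. g (of_real x))"
    by (rule continuous_on_compose2[OF cont]) (auto intro!: continuous_intros real_T)
  define r1 where "r1 = (2 * \<rho> + r) / 3"
  define r2 where "r2 = (\<rho> + 2 * r) / 3"
  have r12: "\<rho> < r1" "r1 < r2" "r2 < r" using r by (auto simp: r1_def r2_def)
  have "compact T"
  proof -
    have "T = cball 0 r \<inter> {z. 0 \<le> Im z}" by (auto simp: T_def)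
    then show ?thesis using compact_Int_closed[OF compact_cball closed_halfspace_Im_ge] by metis
  qed
  then have "bounded (g ` T)" using cont compact_continuous_image compact_imp_bounded by blast
  then obtain M where M: "M > 0" "\<And>z. z \<in> T \<Longrightarrow> norm (g z) \<le> M"
    by (auto simp: bounded_pos)
  obtain x0 where x0: "x0 \<in> {r1..r2}" "\<And>x. x \<in> {r1..r2} \<Longrightarrow> Re (g (of_real x0)) \<le> Re (g (of_real x))"
  proof -
    have "continuous_on {r1..r2} (\<lambda>x. Re (g (of_real x)))"
      using r12 r by (intro continuous_intros continuous_on_subset[OF cont_real]) auto
    then show thesis
      using continuous_attains_inf[of "{r1..r2}"] that r12 by fastforce
  qed
  define c where "c = Re (g (of_real x0))"
  have c: "c > 0" "\<And>x. x \<in> {r1..r2} \<Longrightarrow> c \<le> Re (g (of_real x))"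
    using pos[of x0] x0 r12 r by (auto simp: c_def)
  \<comment> \<open>The sign correcting product is at most \<open>K\<close> in modulus on the half circle and at least \<open>1 / K1\<close>
    on \<open>[r1, r2]\<close>. Neither constant depends on \<open>\<epsilon>\<close> or \<open>k\<close>.\<close>
  define K where "K = exp (2 * \<rho> / (r - \<rho>))"
  define K1 where "K1 = exp (2 * \<rho> / (r1 - \<rho>))"
  have K: "K > 0" "K1 > 0" by (auto simp: K_def K1_def)
  \<comment> \<open>The right-hand side is the bound on the half circle, plus the contribution of \<open>[-\<epsilon>, \<epsilon>]\<close>, where
    the signs are not corrected; the latter is at most \<open>1 \<le> 1 / r ^ k\<close> in modulus.\<close>
  have key: "c / K1 / r2 ^ k * (r2 - r1) \<le> (M * K * r * pi + 1) / r ^ k" if "even k" for k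
  proof -
    obtain \<delta> where \<delta>: "\<delta> > 0" "\<And>z. z \<in> T \<Longrightarrow> norm z < \<delta> \<Longrightarrow> norm (g z) \<le> norm z ^ Suc k"
      using flat[of "Suc k"] by blast
    define \<epsilon> where "\<epsilon> = min (\<delta> / 2) (min (\<rho> / 2) (1 / 2))"
    have \<epsilon>: "0 < \<epsilon>" "\<epsilon> < \<rho>" "\<epsilon> < \<delta>" "\<epsilon> \<le> 1 / 2" using \<delta> r by (auto simp: \<epsilon>_def)
    have "finite {x. \<epsilon> \<le> \<bar>x\<bar> \<and> \<bar>x\<bar> \<le> \<rho> \<and> Re (g (of_real x)) = 0}"
      by (rule finite_subset[OF _ fin[OF \<epsilon>(1)]]) (use zero r in auto)
    moreover have "continuous_on {-\<rho>..\<rho>} (\<lambda>x. Re (g (of_real x)))"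
      using r by (intro continuous_intros continuous_on_subset[OF cont_real]) auto
    moreover have "0 < Re (g (of_real \<rho>))" "0 < Re (g (of_real (-\<rho>)))" using pos[of \<rho>] pos[of "-\<rho>"] r by auto
    ultimately obtain P b where finP: "finite P"
      and P: "\<And>a. a \<in> P \<Longrightarrow> Re (g (of_real a)) = 0 \<and> \<bar>a\<bar> < \<rho> \<and>
        (\<epsilon> \<le> b a \<and> b a < a \<or> a < b a \<and> b a \<le> -\<epsilon>)"
      and gaps: "(\<Sum>a\<in>P. \<bar>a - b a\<bar>) \<le> 2 * \<rho>"
      and sgn: "\<And>x. \<epsilon> \<le> \<bar>x\<bar> \<Longrightarrow> \<bar>x\<bar> \<le> \<rho> \<Longrightarrow>
        0 \<le> Re (g (of_real x)) * (\<Prod>a\<in>P. (x - b a) / (x - a))"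
      using sign_correction[of \<epsilon> \<rho> "\<lambda>x. Re (g (of_real x))"] \<epsilon>(1,2) by blast
    define \<beta> where "\<beta> x = (\<Prod>a\<in>P. (x - b a) / (x - a))" for x
    have \<beta>_small: "\<bar>\<beta> x\<bar> \<le> 1" if "\<bar>x\<bar> \<le> \<epsilon>" for x
      unfolding \<beta>_def abs_prod
    proof (intro prod_le_1 conjI)
      fix a assume "a \<in> P"
      then have "\<bar>x - b a\<bar> \<le> \<bar>x - a\<bar>" using P[of a] that by linarith
      then show "\<bar>(x - b a) / (x - a)\<bar> \<le> 1" by (simp add: abs_divide divide_le_eq_1)
    qed auto
    have \<beta>_pos: "0 \<le> \<beta> x" if "\<rho> \<le> \<bar>x\<bar>" for x
      unfolding \<beta>_def
    proof (intro prod_nonneg)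
      fix a assume "a \<in> P"
      then show "0 \<le> (x - b a) / (x - a)" using P[of a] that \<epsilon>
        by (cases "x \<ge> 0") (auto simp: zero_le_divide_iff)
    qed
    have \<beta>_large: "1 / K1 \<le> \<beta> x" if "r1 \<le> x" for x
    proof -
      have "(\<Prod>a\<in>P. (x - a) / (x - b a)) \<le> exp (\<Sum>a\<in>P. \<bar>a - b a\<bar> / (r1 - \<rho>))"
      proof (rule prod_le_exp_sum)
        fix a assume "a \<in> P"
        then have a: "\<bar>a\<bar> < \<rho>" "\<bar>b a\<bar> < \<rho>" using P[of a] \<epsilon> by auto
        then show "0 \<le> (x - a) / (x - b a)" using that r12 by auto
        have "(x - a) / (x - b a) = 1 + (b a - a) / (x - b a)" using a that r12 by (auto simp: field_simps)
        also have "\<dots> \<le> 1 + \<bar>a - b a\<bar> / (r1 - \<rho>)"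
          using a that r12 by (intro add_left_mono frac_le) auto
        also have "\<dots> \<le> exp (\<bar>a - b a\<bar> / (r1 - \<rho>))" by (rule exp_ge_add_one_self)
        finally show "(x - a) / (x - b a) \<le> exp (\<bar>a - b a\<bar> / (r1 - \<rho>))" .
      qed
      also have "\<dots> \<le> K1" unfolding K1_def sum_divide_distrib[symmetric]
        using gaps r12 by (simp add: divide_right_mono)
      also have "(\<Prod>a\<in>P. (x - a) / (x - b a)) = 1 / \<beta> x"
        unfolding \<beta>_def by (simp add: prod_dividef)
      finally have "1 / \<beta> x \<le> K1" .
      moreover have "\<beta> x > 0" unfolding \<beta>_def
      proof (intro prod_pos)
        fix a assume "a \<in> P"
        then show "0 < (x - b a) / (x - a)" using P[of a] that \<epsilon> r12 by auto
      qed
      ultimately show ?thesis using K by (simp add: field_simps)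
    qed
    define H where "H z = g z * (\<Prod>a\<in>P. (z - of_real (b a)) / (z - of_real a)) / z ^ k" for z :: complex
    have H_arc: "norm (H z) \<le> M * K / r ^ k" if z: "z \<in> T" "norm z = r" for z
    proof -
      have "norm (\<Prod>a\<in>P. (z - of_real (b a)) / (z - of_real a)) \<le> exp (\<Sum>a\<in>P. \<bar>a - b a\<bar> / (r - \<rho>))"
        unfolding prod_norm[symmetric]
      proof (rule prod_le_exp_sum)
        fix a assume "a \<in> P"
        then have a: "\<bar>a\<bar> < \<rho>" using P[of a] by auto
        have dist: "r - \<rho> \<le> norm (z - of_real a)"
          using norm_triangle_ineq2[of z "of_real a"] z a by simp
        then have "z \<noteq> of_real a" using r by auto
        then have "(z - of_real (b a)) / (z - of_real a) = 1 + of_real (a - b a) / (z - of_real a)"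
          by (auto simp: field_simps)
        then have "norm ((z - of_real (b a)) / (z - of_real a)) \<le> 1 + norm (of_real (a - b a) / (z - of_real a))"
          by (metis norm_one norm_triangle_ineq)
        also have "\<dots> = 1 + \<bar>a - b a\<bar> / norm (z - of_real a)"
          by (simp only: norm_divide norm_of_real)
        also have "\<dots> \<le> 1 + \<bar>a - b a\<bar> / (r - \<rho>)"
          using dist r by (intro add_left_mono frac_le) auto
        also have "\<dots> \<le> exp (\<bar>a - b a\<bar> / (r - \<rho>))" by (rule exp_ge_add_one_self)
        finally show "norm ((z - of_real (b a)) / (z - of_real a)) \<le> exp (\<bar>a - b a\<bar> / (r - \<rho>))" .
      qed auto
      also have "\<dots> \<le> K" unfolding K_def sum_divide_distrib[symmetric]
        using gaps r by (simp add: divide_right_mono)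
      finally show ?thesis unfolding H_def norm_divide norm_mult norm_power z(2)
        using M K r z by (intro divide_right_mono mult_mono) auto
    qed
    obtain I where I: "((\<lambda>x. H (of_real x)) has_integral I) {-r..r}" "norm I \<le> M * K / r ^ k * r * pi"
    proof (rule half_disc_moment[where g = g and r = r and \<delta> = \<delta> and k = k and P = P and b = b
          and E = "M * K / r ^ k"])
      show "continuous_on {z. norm z \<le> r \<and> 0 \<le> Im z} g" using cont by (simp add: T_def)
      show "g holomorphic_on {z. norm z < r \<and> 0 < Im z}" by (rule hol)
      show "a \<noteq> 0 \<and> \<bar>a\<bar> < r \<and> g (of_real a) = 0" if "a \<in> P" for a
        using P[OF that] zero[of a] \<epsilon> r by auto
      show "\<exists>D. (g has_field_derivative D) (at (of_real a) within {z. norm z \<le> r \<and> 0 \<le> Im z})"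
        if "a \<in> P" for a
        using der[of a] P[OF that] r by (auto simp: T_def)
      show "norm (g z) \<le> norm z ^ Suc k" if "z \<in> {z. norm z \<le> r \<and> 0 \<le> Im z}" "norm z < \<delta>" for z
        using \<delta>(2)[of z] that by (simp add: T_def)
      show "norm (g z * (\<Prod>a\<in>P. (z - of_real (b a)) / (z - of_real a)) / z ^ k) \<le> M * K / r ^ k"
        if "z \<in> {z. norm z \<le> r \<and> 0 \<le> Im z}" "norm z = r" for z
        using H_arc[of z] that by (simp add: T_def H_def)
    qed (use r \<delta> finP that in \<open>auto simp: H_def\<close>)
    have ReH: "Re (H (of_real x)) = Re (g (of_real x)) * \<beta> x / x ^ k" for x
    proof -
      have "H (of_real x) = g (of_real x) * of_real (\<beta> x / x ^ k)"
        by (simp add: H_def \<beta>_def)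
      then show ?thesis by (simp only: times_complex.sel Re_complex_of_real Im_complex_of_real) simp
    qed
    define A where "A = c / K1 / r2 ^ k"
    have lower: "(if x \<in> {r1..r2} then A else 0) - (if x \<in> {-\<epsilon>..\<epsilon>} then 1 else 0) \<le> Re (H (of_real x))"
      if x: "x \<in> {-r..r}" for x
    proof (cases "\<bar>x\<bar> \<le> \<epsilon>")
      case True
      have "\<bar>Re (H (of_real x))\<bar> \<le> 1"
      proof (cases "x = 0")
        case True
        then show ?thesis using \<delta>(2)[of 0] \<delta>(1) r by (simp add: H_def T_def)
      next
        case False
        have "\<bar>Re (g (of_real x))\<bar> \<le> norm (g (of_real x))" by (rule abs_Re_le_cmod)
        also have "\<dots> \<le> \<bar>x\<bar> ^ Suc k" using \<delta>(2)[of "of_real x"] True \<epsilon> real_T[of x] x by auto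
        finally have "\<bar>Re (g (of_real x))\<bar> * \<bar>\<beta> x\<bar> \<le> \<bar>x\<bar> ^ Suc k * 1"
          using \<beta>_small[OF True] by (intro mult_mono) auto
        then have "\<bar>Re (H (of_real x))\<bar> \<le> \<bar>x\<bar>"
          using False unfolding ReH by (simp add: abs_mult abs_divide power_abs[symmetric] divide_simps)
        then show ?thesis using True \<epsilon> by simp
      qed
      then show ?thesis using True \<epsilon> r12 by auto
    next
      case False
      have xk: "0 \<le> x ^ k" using \<open>even k\<close> by (rule zero_le_even_power)
      have nn: "0 \<le> Re (g (of_real x)) * \<beta> x"
      proof (cases "\<bar>x\<bar> \<le> \<rho>")
        case True
        then show ?thesis using sgn[of x] False by (simp add: \<beta>_def)
      next
        case False
        then show ?thesis using pos[of x] \<beta>_pos[of x] x by (intro mult_nonneg_nonneg) (auto intro: less_imp_le)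
      qed
      have "A \<le> Re (H (of_real x))" if "x \<in> {r1..r2}"
      proof -
        have "c * (1 / K1) / r2 ^ k \<le> Re (g (of_real x)) * \<beta> x / x ^ k"
          using that c(1) c(2)[of x] \<beta>_large[of x] K r r12 nn
          by (intro frac_le mult_mono power_mono) (auto intro!: zero_less_power)
        then show ?thesis by (simp add: A_def ReH)
      qed
      moreover have "0 \<le> Re (H (of_real x))" unfolding ReH using nn xk by (rule divide_nonneg_nonneg)
      ultimately show ?thesis using False by auto
    qed
    have int1: "((\<lambda>x. if x \<in> {r1..r2} then A else 0) has_integral A * (r2 - r1)) {-r..r}"
      using has_integral_const_real[of A r1 r2] r12 r
      by (subst has_integral_restrict) (auto simp: mult.commute)
    have int2: "((\<lambda>x. if x \<in> {-\<epsilon>..\<epsilon>} then 1 else 0) has_integral (2 * \<epsilon>)) {-r..r}"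
      using has_integral_const_real[of "1::real" "-\<epsilon>" \<epsilon>] \<epsilon> r
      by (subst has_integral_restrict) (auto simp: mult.commute)
    have int3: "((\<lambda>x. Re (H (of_real x))) has_integral Re I) {-r..r}"
      using has_integral_linear[OF I(1) bounded_linear_Re] by (simp add: o_def)
    have "A * (r2 - r1) - 2 * \<epsilon> \<le> Re I"
      by (rule has_integral_le[OF has_integral_diff[OF int1 int2] int3]) (rule lower)
    also have "Re I \<le> M * K / r ^ k * r * pi" using I(2) complex_Re_le_cmod[of I] by linarith
    finally have "A * (r2 - r1) \<le> M * K * r * pi / r ^ k + 1" using \<epsilon> by (simp add: algebra_simps)
    also have "1 \<le> 1 / r ^ k" using r by (simp add: power_le_one)
    finally show ?thesis by (simp add: A_def add_divide_distrib)
  qed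
  define q where "q = (r / r2)\<^sup>2"
  have "1 < q" using r r12 by (simp add: q_def one_less_power)
  define L where "L = c / K1 * (r2 - r1)"
  have "L > 0" using c K r12 by (simp add: L_def)
  obtain n where n: "(M * K * r * pi + 1) / L < q ^ n" using real_arch_pow[OF \<open>1 < q\<close>] by blast
  have "L / r2 ^ (2 * n) \<le> (M * K * r * pi + 1) / r ^ (2 * n)"
    using key[of "2 * n"] by (simp add: L_def)
  then have "L * q ^ n \<le> M * K * r * pi + 1"
    using r r12 by (simp add: q_def power_divide power_mult[symmetric] field_simps)
  then show False using n \<open>L > 0\<close> by (simp add: divide_less_eq mult.commute)
qed

section \<open>Flat functions on the upper half disc\<close>

lemma upper_half_disc_eq: "upper_half_disc = ball 0 1 \<inter> {z. 0 < Im z}"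
  by (auto simp: upper_half_disc_def)

lemma open_upper_half_disc: "open upper_half_disc"
  unfolding upper_half_disc_eq by (intro open_Int open_ball open_halfspace_Im_gt)

lemma convex_upper_half_disc: "convex upper_half_disc"
  unfolding upper_half_disc_eq by (intro convex_Int convex_ball convex_halfspace_Im_gt)

lemma upper_half_disc_Un_diameter:
  "upper_half_disc \<union> diameter_segment = {z. norm z < 1 \<and> 0 \<le> Im z}"
proof -
  have "z \<in> diameter_segment" if "norm z < 1" "Im z = 0" for z
  proof -
    have "z = of_real (Re z)" using that by (simp add: complex_eq_iff)
    moreover have "Re z \<in> {-1<..<1}" using that abs_Re_le_cmod[of z] by auto
    ultimately show ?thesis unfolding diameter_segment_def by blast
  qed
  then show ?thesis
    by (auto simp: upper_half_disc_def diameter_segment_def order.order_iff_strict)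
qed

lemma Un_diameter_subset_closure:
  "upper_half_disc \<union> diameter_segment \<subseteq> closure upper_half_disc"
proof (intro Un_least closure_subset subsetI)
  fix z assume "z \<in> diameter_segment"
  then have z: "norm z < 1" "Im z = 0" by (auto simp: diameter_segment_def)
  show "z \<in> closure upper_half_disc"
    unfolding closure_approachable
  proof (intro allI impI)
    fix e :: real assume "0 < e"
    define t where "t = min (e / 2) ((1 - norm z) / 2)"
    have t: "0 < t" "t < e" "norm z + t < 1" using \<open>0 < e\<close> z by (auto simp: t_def min_def field_simps)
    have "norm (z + \<i> * of_real t) \<le> norm z + t"
      using norm_triangle_ineq[of z "\<i> * of_real t"] t by (simp add: norm_mult)
    then have "z + \<i> * of_real t \<in> upper_half_disc" using t z by (simp add: upper_half_disc_def)
    moreover have "dist (z + \<i> * of_real t) z < e" using t by (simp add: dist_norm norm_mult)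
    ultimately show "\<exists>w\<in>upper_half_disc. dist w z < e" by blast
  qed
qed

text \<open>Vanishing to infinite order is a condition on interior limits; the bounds it gives extend to the
  diameter by continuity.\<close>

lemma flat_bound_up_to_diameter:
  assumes "vanishes_to_infinite_order_at_0 f upper_half_disc"
    and cont: "continuous_on (upper_half_disc \<union> diameter_segment) f"
  shows "\<exists>\<delta>>0. \<forall>z\<in>upper_half_disc \<union> diameter_segment. norm z < \<delta> \<longrightarrow> norm (f z) \<le> norm z ^ k"
proof -
  let ?S = upper_half_disc and ?T = "upper_half_disc \<union> diameter_segment"
  have "((\<lambda>z. f z / of_real (norm z ^ k)) \<longlongrightarrow> 0) (at 0 within ?S)"
    using assms(1) unfolding vanishes_to_infinite_order_at_0_def by blast
  then have "eventually (\<lambda>z. dist (f z / of_real (norm z ^ k)) 0 < 1) (at 0 within ?S)"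
    by (rule tendstoD) simp
  then obtain \<delta> where \<delta>: "\<delta> > 0"
    "\<And>z. z \<in> ?S \<Longrightarrow> z \<noteq> 0 \<Longrightarrow> dist z 0 < \<delta> \<Longrightarrow> dist (f z / of_real (norm z ^ k)) 0 < 1"
    unfolding eventually_at by metis
  have inner: "norm (f z) \<le> norm z ^ k" if "z \<in> ?S" "norm z < \<delta>" for z
  proof -
    have "z \<noteq> 0" using that by (auto simp: upper_half_disc_def)
    then show ?thesis using \<delta>(2)[of z] that by (simp add: norm_divide norm_power divide_less_eq)
  qed
  have "norm (f z) \<le> norm z ^ k" if z: "z \<in> ?T" "norm z < \<delta>" for z
  proof -
    obtain X where X: "\<And>n. X n \<in> ?S \<inter> ball 0 \<delta>" "X \<longlonglongrightarrow> z"
      using approximate_from_dense_subset[OF Un_diameter_subset_closure open_ball, of z 0 \<delta>] z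
      by auto
    show ?thesis
    proof (rule LIMSEQ_le)
      show "(\<lambda>n. norm (f (X n))) \<longlonglongrightarrow> norm (f z)"
        using X z by (intro tendsto_norm continuous_on_tendsto_compose[OF cont] always_eventually) auto
      show "(\<lambda>n. norm (X n) ^ k) \<longlonglongrightarrow> norm z ^ k" by (intro tendsto_intros X)
    qed (use X inner in auto)
  qed
  then show ?thesis using \<delta>(1) by blast
qed

lemma smooth_up_to_has_boundary_derivative:
  assumes "f holomorphic_on upper_half_disc"
    and "smooth_up_to f upper_half_disc diameter_segment"
    and "z \<in> upper_half_disc \<union> diameter_segment"
  shows "\<exists>D. (f has_field_derivative D) (at z within upper_half_disc \<union> diameter_segment)"
proof -
  let ?S = upper_half_disc and ?T = "upper_half_disc \<union> diameter_segment"
  have cont: "continuous_on ?T f" using assms(2) by (simp add: smooth_up_to_def)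
  obtain g where g: "continuous_on ?T g" "\<And>x. x \<in> ?S \<Longrightarrow> g x = iter_deriv [1] f x"
    using assms(2) unfolding smooth_up_to_def by metis
  have der: "(f has_field_derivative g x) (at x)" if "x \<in> ?S" for x
  proof -
    have d: "(f has_field_derivative deriv f x) (at x)"
      using holomorphic_derivI[OF assms(1) open_upper_half_disc that] .
    then have "frechet_derivative f (at x) = (*) (deriv f x)"
      unfolding has_field_derivative_def by (rule frechet_derivative_at[symmetric])
    then have "g x = deriv f x" using g(2)[OF that] by simp
    then show ?thesis using d by simp
  qed
  show ?thesis
    using has_field_derivative_boundary[OF open_upper_half_disc convex_upper_half_disc
        Un_diameter_subset_closure _ cont g(1) der assms(3)] by auto
qed

theorem corollary1:
  fixes f :: "complex \<Rightarrow> complex" and C :: real and Z :: "complex set"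
  defines "Z \<equiv> {z \<in> diameter_segment. f z = 0}"
  assumes "f holomorphic_on upper_half_disc"
    and "smooth_up_to f upper_half_disc diameter_segment"
    and "C > 0"
    and "f ` diameter_segment \<subseteq> double_cone C"
    and "\<forall>z \<in> Z - {0}. z isolated_in Z"
    and "\<forall>z \<in> diameter_segment. z islimpt Z \<longrightarrow> z = 0"
    and "vanishes_to_infinite_order_at_0 f upper_half_disc"
  shows "\<forall>z \<in> upper_half_disc \<union> diameter_segment. f z = 0"
proof -
  note hol = assms(2) and smooth = assms(3) and cone = assms(5) and limpt = assms(7)
    and flat = assms(8)
  let ?S = upper_half_disc and ?T = "upper_half_disc \<union> diameter_segment"
  have cont: "continuous_on ?T f" using smooth by (simp add: smooth_up_to_def)
  note flatT = flat_bound_up_to_diameter[OF flat cont]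
  have real_B: "of_real x \<in> diameter_segment" if "\<bar>x\<bar> < 1" for x
    using that by (auto simp: diameter_segment_def intro!: imageI)
  have cont_real: "continuous_on {-1<..<1} (\<lambda>x. Re (f (of_real x)))"
    by (rule continuous_on_Re[OF continuous_on_compose2[OF cont]])
      (auto intro!: continuous_intros real_B)
  have f0: "f 0 = 0"
    using flatT[of 1] real_B[of 0] by (force simp: Ball_def)
  have zero_iff: "Re (f (of_real x)) = 0 \<longleftrightarrow> f (of_real x) = 0" if "\<bar>x\<bar> < 1" for x
    using cone real_B[OF that] by (force simp: double_cone_def complex_eq_iff)
  have fin: "finite {x::real. \<epsilon> \<le> \<bar>x\<bar> \<and> \<bar>x\<bar> \<le> \<rho> \<and> f (of_real x) = 0}"
    if "0 < \<epsilon>" "\<rho> < 1" for \<epsilon> \<rho>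
  proof -
    let ?A = "of_real ` ({\<epsilon>..\<rho>} \<union> {-\<rho>..-\<epsilon>}) :: complex set"
    have "finite (?A \<inter> Z)"
    proof (rule finite_not_islimpt_in_compact)
      show "compact ?A" by (intro compact_continuous_image continuous_intros compact_Un) auto
      show "\<not> z islimpt Z" if "z \<in> ?A" for z
        using that limpt real_B \<open>0 < \<epsilon>\<close> \<open>\<rho> < 1\<close> by fastforce
    qed
    then have "finite (of_real -` (?A \<inter> Z))" by (intro finite_vimageI injI) auto
    then show ?thesis
      by (rule finite_subset[rotated]) (use that real_B in \<open>auto simp: assms(1) image_iff abs_if split: if_splits\<close>)
  qed
  \<comment> \<open>Finitely many zeros satisfy \<open>1/4 \<le> \<bar>x\<bar> \<le> 1/2\<close>, so some closed interval of moduli \<open>[\<rho>, r]\<close> avoids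
    them on both sides of \<open>0\<close>.\<close>
  define N where "N = abs ` {x::real. 1/4 \<le> \<bar>x\<bar> \<and> \<bar>x\<bar> \<le> 1/2 \<and> f (of_real x) = 0}"
  have "finite N" unfolding N_def using fin[of "1/4" "1/2"] by simp
  then have "open ({1/4<..<1/2} - N)" by (intro open_Diff finite_imp_closed) auto
  moreover have "{1/4<..<1/2} - N \<noteq> {}"
    using infinite_super[OF _ infinite_Ioo[of "1/4::real" "1/2"]] \<open>finite N\<close> by auto
  ultimately obtain p e where pe: "e > 0" "cball p e \<subseteq> {1/4<..<1/2} - N"
    by (meson ex_in_conv open_contains_cball)
  define \<rho> where "\<rho> = p - e"
  define r where "r = p + e"
  have sub: "{\<rho>..r} \<subseteq> {1/4<..<1/2} - N" using pe by (simp add: cball_eq_atLeastAtMost \<rho>_def r_def)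
  have "\<rho> < r" using pe(1) by (simp add: \<rho>_def r_def)
  moreover from this have "\<rho> \<in> {1/4<..<1/2} - N" "r \<in> {1/4<..<1/2} - N"
    using sub by (auto simp only: subset_iff atLeastAtMost_iff order.refl less_imp_le)
  ultimately have r: "1/4 < \<rho>" "\<rho> < r" "r < 1/2" by auto
  have nz: "Re (f (of_real x)) \<noteq> 0" if "\<rho> \<le> \<bar>x\<bar>" "\<bar>x\<bar> \<le> r" for x
  proof
    assume "Re (f (of_real x)) = 0"
    then have "f (of_real x) = 0" using zero_iff that r by auto
    then have "\<bar>x\<bar> \<in> N" using that r unfolding N_def by (intro imageI) auto
    then show False using sub that by auto
  qed
  have same_pos: "Re (f (of_real x)) < 0 \<longleftrightarrow> Re (f (of_real r)) < 0" if "\<rho> \<le> x" "x \<le> r" for x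
    using that r nz
    by (intro same_sign_if_no_zero[of x r "\<lambda>x. Re (f (of_real x))"] continuous_on_subset[OF cont_real]) auto
  have same_neg: "Re (f (of_real (-r))) < 0 \<longleftrightarrow> Re (f (of_real x)) < 0" if "-r \<le> x" "x \<le> -\<rho>" for x
    using that r nz
    by (intro same_sign_if_no_zero[of "-r" x "\<lambda>x. Re (f (of_real x))"] continuous_on_subset[OF cont_real]) auto
  \<comment> \<open>The sign \<open>s\<close> makes the right end positive, and the factor \<open>z\<close> (that is, \<open>m = 1\<close>) is used when the
    two ends have opposite signs.\<close>
  define s :: real where "s = (if Re (f (of_real r)) < 0 then -1 else 1)"
  define m :: nat where "m = (if Re (f (of_real r)) < 0 \<longleftrightarrow> Re (f (of_real (-r))) < 0 then 0 else 1)"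
  define g where "g z = of_real s * z ^ m * f z" for z
  have g_real: "g (of_real x) = of_real (s * x ^ m) * f (of_real x)" for x by (simp add: g_def)
  have Re_g: "Re (g (of_real x)) = s * x ^ m * Re (f (of_real x))" for x
    unfolding g_real by simp
  let ?Tr = "{z. norm z \<le> r \<and> 0 \<le> Im z}"
  have Tr: "?Tr \<subseteq> ?T" using r by (auto simp: upper_half_disc_Un_diameter)
  have g_zero: "g (of_real x) = 0 \<longleftrightarrow> f (of_real x) = 0" for x
    using f0 by (auto simp: g_real s_def)
  have g_le: "norm (g z) \<le> norm (f z)" if "norm z \<le> 1" for z
  proof -
    have "norm (of_real s * z ^ m) \<le> 1" using that by (auto simp: s_def m_def)
    then show ?thesis unfolding g_def norm_mult[of "_ * _"] by (rule mult_left_le_one_le[rotated 2]) auto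
  qed
  have False
  proof (rule flat_contradiction[of \<rho> r g])
    show "continuous_on ?Tr g"
      unfolding g_def by (intro continuous_intros continuous_on_subset[OF cont Tr])
    show "g holomorphic_on {z. norm z < r \<and> 0 < Im z}"
      unfolding g_def using r
      by (intro holomorphic_intros holomorphic_on_subset[OF hol]) (auto simp: upper_half_disc_def)
    show "\<exists>\<delta>>0. \<forall>z\<in>?Tr. norm z < \<delta> \<longrightarrow> norm (g z) \<le> norm z ^ k" for k
    proof -
      obtain \<delta> where \<delta>: "\<delta> > 0" "\<And>z. z \<in> ?T \<Longrightarrow> norm z < \<delta> \<Longrightarrow> norm (f z) \<le> norm z ^ k"
        using flatT[of k] by blast
      have "norm (g z) \<le> norm z ^ k" if "z \<in> ?Tr" "norm z < \<delta>" for z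
        using \<delta>(2)[of z] g_le[of z] that Tr r by fastforce
      then show ?thesis using \<delta>(1) by blast
    qed
    show "\<exists>D. (g has_field_derivative D) (at (of_real x) within ?Tr)" if "\<bar>x\<bar> < r" for x
    proof -
      have "of_real x \<in> ?T" using real_B[of x] that r by auto
      then obtain D where "(f has_field_derivative D) (at (of_real x) within ?T)"
        using smooth_up_to_has_boundary_derivative[OF hol smooth] by blast
      then have "(f has_field_derivative D) (at (of_real x) within ?Tr)" by (rule DERIV_subset) (rule Tr)
      then show ?thesis unfolding g_def by (intro exI) (auto intro!: derivative_eq_intros)
    qed
    show "g (of_real x) = 0" if "\<bar>x\<bar> < r" "Re (g (of_real x)) = 0" for x
      using that zero_iff[of x] r f0 unfolding g_zero by (auto simp: Re_g s_def split: if_splits)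
    show "0 < Re (g (of_real x))" if x: "\<rho> \<le> \<bar>x\<bar>" "\<bar>x\<bar> \<le> r" for x
    proof (cases "x \<ge> 0")
      case True
      then have "0 < s * Re (f (of_real x))" "0 < x ^ m"
        using same_pos[of x] nz[of x] x r by (auto simp: s_def)
      then show ?thesis unfolding Re_g by (metis mult.assoc mult.left_commute mult_pos_pos)
    next
      case False
      then show ?thesis unfolding Re_g
        using same_neg[of x] nz[of x] nz[of r] nz[of "-r"] x r
        by (auto simp: s_def m_def zero_less_mult_iff mult_less_0_iff not_less)
    qed
    show "finite {x::real. \<epsilon> \<le> \<bar>x\<bar> \<and> \<bar>x\<bar> \<le> \<rho> \<and> g (of_real x) = 0}" if "0 < \<epsilon>" for \<epsilon>
      unfolding g_zero using fin[of \<epsilon> \<rho>] that r by simp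
  qed (use r in auto)
  then show ?thesis ..
qed

end
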